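(* Let $3\le r\le 8$ and let $S_r$ be a del Pezzo surface obtained by blowing up $\mathbb{P}^2$ at $r$ points in general position. Then the set of lines $L_r\subset Pic\,S_r$ is the set of vertices of a Gosset polytope $(r-4)_{21}$ in the hyperplane section $\tilde H_1$ of $Pic\,S_r\otimes\mathbb{Q}$.
   Context: General position: no three points on a line, no six on a conic and, for $r=8$, not all eight on a plane cubic that is singular at one of them. $Pic\,S_r=\mathbb{Z}h\oplus\mathbb{Z}e_1\oplus\dots\oplus\mathbb{Z}e_r$ with intersection form $h^2=1$, $h\cdot e_i=0$, $e_i\cdot e_j=-\delta_{ij}$, and $K_{S_r}=-3h+\sum_{i=1}^r e_i$. The set of lines is $L_r=\{l\in Pic\,S_r\mid l^2=l\cdot K_{S_r}=-1\}$. $\tilde H_b=\{D\in Pic\,S_r\otimes\mathbb{Q}\mid -D\cdot K_{S_r}=b\}$. The intersection form is negative definite on differences of elements of $\tilde H_b$; its negative gives the Euclidean metric on $\tilde H_b$ used for speaking of polytopes (convex hulls) in $\tilde H_1$ (extend scalars to $\mathbb{R}$ if desired). Gosset polytope $(r-4)_{21}$: the $r$-dimensional semiregular polytope (defined up to similarity) with symmetry group the Coxeter group $E_r$ (with $E_3=A_1\times A_2$, $E_4=A_4$, $E_5=D_5$), obtained as the convex hull of an orbit of $E_r$ as follows. The Coxeter–Dynkin diagram of $E_r$ has nodes $0,1,\dots,r-1$ where $1-2-\dots-(r-1)$ is a chain and node $0$ is joined to node $3$ only (for $r=3$ node $0$ is isolated). For $r\ge4$ one takes the orbit of a nonzero point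 lying on all mirrors except the one of the node $r-1$; for $r=3$ one takes the orbit of a point lying on the mirror of node $1$ and off the mirrors of nodes $0$ and $2$, at equal distance from both (giving the triangular prism with square side faces, $-1_{21}$). Thus $0_{21}$ is the rectified 5-cell, $1_{21}$ the demipenteract, and $2_{21},3_{21},4_{21}$ have $27,56,240$ vertices. *)

theory Defs
  imports "HOL-Analysis.Analysis" "HOL-Computational_Algebra.Polynomial"
begin

section \<open>Points in general position in the projective plane\<close>

text \<open>
  Points of the plane are given by homogeneous coordinates in \<open>'k ^ 3\<close>, so they have to be
  nonzero.  A plane curve of degree \<open>d\<close> is given by a nonzero ternary form of degree \<open>d\<close>; it may
  be reducible or nonreduced.  The form is given by the family \<open>c\<close> of its coefficients; values
  of \<open>c\<close> outside \<open>monomials d\<close> are irrelevant.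
\<close>

definition monomials :: "nat \<Rightarrow> (nat \<times> nat \<times> nat) set" where
  "monomials d = {(i, j, k). i + j + k = d}"

definition nonzero_form :: "nat \<Rightarrow> (nat \<times> nat \<times> nat \<Rightarrow> 'k::field) \<Rightarrow> bool" where
  "nonzero_form d c \<longleftrightarrow> (\<exists>m\<in>monomials d. c m \<noteq> 0)"

definition form_value :: "nat \<Rightarrow> (nat \<times> nat \<times> nat \<Rightarrow> 'k::field) \<Rightarrow> 'k ^ 3 \<Rightarrow> 'k" where
  "form_value d c x =
     (\<Sum>(i, j, k)\<in>monomials d. c (i, j, k) * (x $ 1) ^ i * (x $ 2) ^ j * (x $ 3) ^ k)"

text \<open>
  The values at \<open>x\<close> of the three partial derivatives of the form.  The exponents \<open>i - 1\<close> etc. are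
  truncated only where the integer factor vanishes.
\<close>

definition form_gradient :: "nat \<Rightarrow> (nat \<times> nat \<times> nat \<Rightarrow> 'k::field) \<Rightarrow> 'k ^ 3 \<Rightarrow> 'k ^ 3" where
  "form_gradient d c x = vector
     [\<Sum>(i, j, k)\<in>monomials d. c (i, j, k) * (of_nat i * (x $ 1) ^ (i - 1)) * (x $ 2) ^ j * (x $ 3) ^ k,
      \<Sum>(i, j, k)\<in>monomials d. c (i, j, k) * (x $ 1) ^ i * (of_nat j * (x $ 2) ^ (j - 1)) * (x $ 3) ^ k,
      \<Sum>(i, j, k)\<in>monomials d. c (i, j, k) * (x $ 1) ^ i * (x $ 2) ^ j * (of_nat k * (x $ 3) ^ (k - 1))]"

definition on_common_curve :: "nat \<Rightarrow> ('n \<Rightarrow> 'k::field ^ 3) \<Rightarrow> 'n set \<Rightarrow> bool" where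
  "on_common_curve d p A \<longleftrightarrow> (\<exists>c. nonzero_form d c \<and> (\<forall>i\<in>A. form_value d c (p i) = 0))"

text \<open>
  With at least three points, the condition on lines also forces the points to be pairwise distinct,
  because three indices whose points are not all different are always on a common line.
\<close>

definition general_position :: "('n::finite \<Rightarrow> 'k::field ^ 3) \<Rightarrow> bool" where
  "general_position p \<longleftrightarrow>
     (\<forall>i. p i \<noteq> 0) \<and>
     (\<forall>A. card A = 3 \<longrightarrow> \<not> on_common_curve 1 p A) \<and>
     (\<forall>A. card A = 6 \<longrightarrow> \<not> on_common_curve 2 p A) \<and>
     (CARD('n) = 8 \<longrightarrow>
        \<not> (\<exists>c. nonzero_form 3 c \<and> (\<forall>i. form_value 3 c (p i) = 0) \<and>
              (\<exists>i. form_gradient 3 c (p i) = 0)))"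


section \<open>The Picard lattice of the blow-up\<close>

text \<open>
  Let \<open>S\<close> be the blow-up of the plane at points indexed by \<open>'n\<close>, and let \<open>h\<close> be the class of the
  pull-back of a line and \<open>e i\<close> the class of the exceptional curve over the point with index \<open>i\<close>.
  The group \<open>Pic S\<close> is free with basis \<open>h\<close> and all \<open>e i\<close>.  The pair \<open>(a, b)\<close> stands for
  the class \<open>a h + (\<Sum>i. b\<^sub>i e\<^sub>i)\<close>: pairs in \<open>int \<times> (int ^ 'n)\<close> are the elements of \<open>Pic S\<close>, and
  pairs in \<open>real \<times> (real ^ 'n)\<close> those of its extension of scalars to the reals.

  On \<open>real \<times> (real ^ 'n)\<close>, the metric that matters is the one coming from the intersection form, and
  not the one of the type class \<open>euclidean_space\<close>.
\<close>

type_synonym ('a, 'n) pic = "'a \<times> ('a ^ 'n)"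

definition pic_h :: "('a::comm_ring_1, 'n::finite) pic" where
  "pic_h = (1, 0)"

definition pic_e :: "'n \<Rightarrow> ('a::comm_ring_1, 'n::finite) pic" where
  "pic_e i = (0, axis i 1)"

definition pic_K :: "('a::comm_ring_1, 'n::finite) pic" where
  "pic_K = - (pic_h + pic_h + pic_h) + (\<Sum>i\<in>UNIV. pic_e i)"

definition intersection ::
  "('a::comm_ring_1, 'n::finite) pic \<Rightarrow> ('a, 'n) pic \<Rightarrow> 'a" (infixl \<open>\<cdot>\<^sub>P\<close> 70) where
  "D \<cdot>\<^sub>P D' = fst D * fst D' - (\<Sum>i\<in>UNIV. snd D $ i * snd D' $ i)"

definition pic_real :: "(int, 'n::finite) pic \<Rightarrow> (real, 'n) pic" where
  "pic_real D = (of_int (fst D), \<chi> i. of_int (snd D $ i))"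

definition lines_on_S :: "(int, 'n::finite) pic set" where
  "lines_on_S = {l. l \<cdot>\<^sub>P l = -1 \<and> l \<cdot>\<^sub>P pic_K = -1}"

definition hyperplane_section :: "real \<Rightarrow> (real, 'n::finite) pic set" where
  "hyperplane_section b = {D. - (D \<cdot>\<^sub>P pic_K) = b}"


section \<open>Gosset polytopes\<close>

definition mirror :: "'a::euclidean_space \<Rightarrow> 'a set" where
  "mirror a = {x. a \<bullet> x = 0}"

definition reflection :: "'a::euclidean_space \<Rightarrow> 'a \<Rightarrow> 'a" where
  "reflection a x = x - (2 * (a \<bullet> x) / (a \<bullet> a)) *\<^sub>R a"

text \<open>
  Closure under inverses is automatic, because reflections are involutions.
\<close>

inductive_set reflection_group :: "'a::euclidean_space set \<Rightarrow> ('a \<Rightarrow> 'a) set"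
  for A :: "'a set" where
  one: "id \<in> reflection_group A"
| mult: "a \<in> A \<Longrightarrow> w \<in> reflection_group A \<Longrightarrow> reflection a \<circ> w \<in> reflection_group A"

text \<open>
  The Coxeter diagram of \<open>E\<^sub>r\<close> has the nodes \<open>0, \<dots>, r - 1\<close>.  There is no edge \<open>0 - 1\<close>, and for
  \<open>r = 3\<close> the node \<open>0\<close> is isolated because \<open>3\<close> is not a node.
\<close>

definition E_edge :: "nat \<Rightarrow> nat \<Rightarrow> bool" where
  "E_edge i j \<longleftrightarrow> (1 \<le> i \<and> j = i + 1) \<or> (1 \<le> j \<and> i = j + 1) \<or> {i, j} = {0, 3}"

definition E_coxeter_matrix :: "nat \<Rightarrow> nat \<Rightarrow> nat" where
  "E_coxeter_matrix i j = (if i = j then 1 else if E_edge i j then 3 else 2)"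

text \<open>
  Unit normal vectors of the mirrors of the generating reflections of a Coxeter group of type
  \<open>E\<^sub>r\<close>; the mirrors of \<open>i\<close> and \<open>j\<close> meet at the angle \<open>\<pi> / m\<^sub>i\<^sub>j\<close>.
  The diagonal case \<open>m\<^sub>i\<^sub>i = 1\<close> says that the normals have length one.
\<close>

definition E_simple_system :: "nat \<Rightarrow> (nat \<Rightarrow> 'a::euclidean_space) \<Rightarrow> bool" where
  "E_simple_system r \<alpha> \<longleftrightarrow>
     (\<forall>i<r. \<forall>j<r. \<alpha> i \<bullet> \<alpha> j = - cos (pi / real (E_coxeter_matrix i j)))"

definition gosset_generator :: "nat \<Rightarrow> (nat \<Rightarrow> 'a::euclidean_space) \<Rightarrow> 'a \<Rightarrow> bool" where
  "gosset_generator r \<alpha> v \<longleftrightarrow>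
     (if r = 3 then
        v \<in> mirror (\<alpha> 1) \<and> v \<notin> mirror (\<alpha> 0) \<and> v \<notin> mirror (\<alpha> 2) \<and>
        infdist v (mirror (\<alpha> 0)) = infdist v (mirror (\<alpha> 2))
      else
        v \<noteq> 0 \<and> v \<notin> mirror (\<alpha> (r - 1)) \<and> (\<forall>i < r - 1. v \<in> mirror (\<alpha> i)))"

text \<open>
  \<open>P\<close> is a Gosset polytope \<open>(r - 4)\<^sub>2\<^sub>1\<close>, centred at the origin, in a Euclidean space of
  dimension \<open>r\<close>.
\<close>

definition gosset_polytope :: "nat \<Rightarrow> 'a::euclidean_space set \<Rightarrow> bool" where
  "gosset_polytope r P \<longleftrightarrow>
     DIM('a) = r \<and>
     (\<exists>\<alpha> v. E_simple_system r \<alpha> \<and> gosset_generator r \<alpha> v \<and>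
            P = convex hull ((\<lambda>w. w v) ` reflection_group (\<alpha> ` {..<r})))"

text \<open>
  A similarity of ordinary Euclidean space onto the hyperplane section of parameter \<open>b\<close>, where the
  latter carries the metric given by the negative of the intersection form.
\<close>

definition similarity_onto_section ::
  "real \<Rightarrow> (real ^ 'n::finite \<Rightarrow> (real, 'n) pic) \<Rightarrow> bool" where
  "similarity_onto_section b f \<longleftrightarrow>
     range f = hyperplane_section b \<and>
     (\<exists>s>0. \<forall>x y. - ((f x - f y) \<cdot>\<^sub>P (f x - f y)) = (s * dist x y)\<^sup>2)"

definition gosset_polytope_in_section :: "real \<Rightarrow> (real, 'n::finite) pic set \<Rightarrow> bool" where
  "gosset_polytope_in_section b P \<longleftrightarrow>
     (\<exists>(f :: real ^ 'n \<Rightarrow> (real, 'n) pic) Q.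
        similarity_onto_section b f \<and> gosset_polytope CARD('n) Q \<and> P = f ` Q)"

end

theory Submission
  imports Defs
begin

text \<open>
  Write \<open>r\<close> for the number of points, \<open>3 \<le> r \<le> 8\<close>, and \<open>e\<^sub>1, \<dots>, e\<^sub>r\<close> for the exceptional classes.
  The classes \<open>h - e\<^sub>1 - e\<^sub>2 - e\<^sub>3\<close> and \<open>e\<^sub>i - e\<^sub>i\<^sub>+\<^sub>1\<close> have square \<open>-2\<close>, are orthogonal to \<open>K\<close>, and
  their intersection numbers are those of the diagram of \<open>E\<^sub>r\<close> (\<open>simple_root_gram\<close>).  Since
  \<open>K\<^sup>2 = 9 - r > 0\<close>, the negative of the intersection form is positive definite on the orthogonal
  complement of \<open>K\<close>.  It makes the hyperplane section a Euclidean space, whose natural origin is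
  the multiple \<open>- K / (9 - r)\<close> of \<open>K\<close>: this point is fixed by all the reflections in the roots, which
  therefore act linearly and generate a Coxeter group of type \<open>E\<^sub>r\<close>.

  The class \<open>e\<^sub>r\<close> meets exactly one simple root, that of the node \<open>r - 1\<close>, when \<open>r \<ge> 4\<close>; for \<open>r = 3\<close> it
  meets the roots of the nodes \<open>0\<close> and \<open>2\<close>, and with both it has intersection number \<open>1\<close>.  So it is a
  generating vertex of the Gosset polytope (\<open>gosset_generator_vertex\<close>), and two facts remain.

  The orbit of \<open>e\<^sub>r\<close> is the set of all lines (\<open>orbit_eq_vertices\<close>).  The reflections preserve lines.
  Conversely, a line that has negative intersection with a simple root is moved by the
  corresponding reflection to a line of smaller height, for a linear height function that is
  positive on the simple roots and bounded below on lines; so after finitely many reflections one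
  reaches a line that has nonnegative intersection with every simple root.  Such a line is \<open>e\<^sub>r\<close>
  (\<open>dominant_line\<close>): if it were not exceptional over one of the points, its multiplicities
  \<open>m\<^sub>1 \<ge> \<dots> \<ge> m\<^sub>r\<close> at the points would be nonnegative and its degree at least \<open>m\<^sub>1 + m\<^sub>2 + m\<^sub>3\<close>, against
  Noether's inequality (\<open>noether_inequality\<close>).

  Finally, all lines are extreme points of their convex hull because they lie on a common sphere
  around the origin of the section (\<open>norm_vertex\<close>, \<open>extreme_points_convex_hull_in_sphere\<close>).
\<close>

section \<open>The intersection form\<close>

lemma intersection_commute: "D \<cdot>\<^sub>P D' = D' \<cdot>\<^sub>P D"
  by (simp add: intersection_def mult.commute)

lemma intersection_add_left: "(D + D') \<cdot>\<^sub>P F = D \<cdot>\<^sub>P F + D' \<cdot>\<^sub>P F"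
  by (simp add: intersection_def algebra_simps sum.distrib)

lemma intersection_minus_left: "(- D) \<cdot>\<^sub>P F = - (D \<cdot>\<^sub>P F)"
  by (simp add: intersection_def algebra_simps sum_negf)

lemma intersection_diff_left: "(D - D') \<cdot>\<^sub>P F = D \<cdot>\<^sub>P F - D' \<cdot>\<^sub>P F"
  using intersection_add_left[of D "- D'" F] by (simp add: intersection_minus_left)

lemma intersection_add_right: "F \<cdot>\<^sub>P (D + D') = F \<cdot>\<^sub>P D + F \<cdot>\<^sub>P D'"
  by (simp add: intersection_commute[of F] intersection_add_left)

lemma intersection_diff_right: "F \<cdot>\<^sub>P (D - D') = F \<cdot>\<^sub>P D - F \<cdot>\<^sub>P D'"
  by (simp add: intersection_commute[of F] intersection_diff_left)

lemma intersection_scaleR_left: "(c *\<^sub>R D) \<cdot>\<^sub>P F = c * (D \<cdot>\<^sub>P F)"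
  by (simp add: intersection_def algebra_simps sum_distrib_left)

lemmas intersection_bilinear =
  intersection_add_left intersection_add_right intersection_diff_left intersection_diff_right

lemma intersection_pic_e_right: "D \<cdot>\<^sub>P pic_e i = - (snd D $ i)"
  by (simp add: intersection_def pic_e_def axis_def if_distrib cong: if_cong)

lemma intersection_pic_h_right: "D \<cdot>\<^sub>P pic_h = fst D"
  by (simp add: intersection_def pic_h_def)

lemma pic_e_nth: "fst (pic_e i) = 0" "snd (pic_e i) $ j = (if i = j then 1 else 0)"
  by (auto simp: pic_e_def axis_def)

lemma pic_h_nth: "fst pic_h = 1" "snd pic_h $ j = 0"
  by (auto simp: pic_h_def)

lemmas intersection_basis =
  intersection_pic_e_right intersection_pic_h_right pic_e_nth pic_h_nth

lemma pic_K_eq: "pic_K = (- 3, 1)"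
  by (simp add: pic_K_def pic_h_def pic_e_def prod_eq_iff fst_sum snd_sum vec_eq_iff axis_def)

lemma intersection_pic_K_right: "D \<cdot>\<^sub>P pic_K = - 3 * fst D - (\<Sum>i\<in>UNIV. snd D $ i)"
  by (simp add: intersection_def pic_K_eq)

lemma intersection_pic_real: "pic_real D \<cdot>\<^sub>P pic_real D' = of_int (D \<cdot>\<^sub>P D')"
  by (simp add: intersection_def pic_real_def)

lemma pic_real_add: "pic_real (D + D') = pic_real D + pic_real D'"
  by (simp add: pic_real_def prod_eq_iff vec_eq_iff)

lemma pic_real_K: "pic_real pic_K = pic_K"
  by (simp add: pic_real_def pic_K_eq prod_eq_iff vec_eq_iff)

lemma pic_real_eq_0_iff: "pic_real D = 0 \<longleftrightarrow> D = 0"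
  by (simp add: pic_real_def prod_eq_iff vec_eq_iff)

definition pic_scale :: "int \<Rightarrow> (int, 'n::finite) pic \<Rightarrow> (int, 'n) pic" where
  "pic_scale k D = (k * fst D, k *s snd D)"

lemma intersection_pic_scale:
  "pic_scale k D \<cdot>\<^sub>P F = k * (D \<cdot>\<^sub>P F)"  "F \<cdot>\<^sub>P pic_scale k D = k * (F \<cdot>\<^sub>P D)"
  by (simp_all add: intersection_def pic_scale_def algebra_simps sum_distrib_left)

lemma pic_real_scale: "pic_real (pic_scale k D) = of_int k *\<^sub>R pic_real D"
  by (simp add: pic_real_def pic_scale_def prod_eq_iff vec_eq_iff)

text \<open>
  The usual formula \<open>D - 2 (D \<cdot> \<alpha>) / (\<alpha> \<cdot> \<alpha>) \<alpha>\<close> for a class \<open>\<alpha>\<close> of square \<open>-2\<close>, where no division is left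
  and the lattice is preserved.
\<close>

definition root_reflection :: "(int, 'n::finite) pic \<Rightarrow> (int, 'n) pic \<Rightarrow> (int, 'n) pic" where
  "root_reflection \<alpha> D = D + pic_scale (D \<cdot>\<^sub>P \<alpha>) \<alpha>"

lemma root_reflection_involution:
  assumes "\<alpha> \<cdot>\<^sub>P \<alpha> = - 2"
  shows "root_reflection \<alpha> (root_reflection \<alpha> D) = D"
proof -
  have "root_reflection \<alpha> D \<cdot>\<^sub>P \<alpha> = - (D \<cdot>\<^sub>P \<alpha>)"
    using assms by (simp add: root_reflection_def intersection_add_left intersection_pic_scale)
  then show ?thesis
    unfolding root_reflection_def[of \<alpha> "root_reflection \<alpha> D"]
    by (simp add: root_reflection_def pic_scale_def prod_eq_iff vec_eq_iff)
qed

lemma root_reflection_preserves_lines: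
  assumes "\<alpha> \<cdot>\<^sub>P \<alpha> = - 2" and "\<alpha> \<cdot>\<^sub>P pic_K = 0" and "l \<in> lines_on_S"
  shows "root_reflection \<alpha> l \<in> lines_on_S"
  using assms
  by (simp add: lines_on_S_def root_reflection_def intersection_bilinear intersection_pic_scale
      intersection_commute[of \<alpha> l])

section \<open>Euclidean coordinates on the hyperplane section\<close>

text \<open>
  A class orthogonal to \<open>K\<close> is determined by its components along the exceptional classes, but
  these components are not orthonormal coordinates: with \<open>S\<close> their sum, the first component is
  \<open>- S / 3\<close>, and the negative of the form is the sum of their squares minus \<open>S\<^sup>2 / 9\<close>.  Only the
  direction of the all-ones vector needs correction.  Adding \<open>t\<close> times the first component to each
  of the other components gives an isometry exactly when
  \<open>r t\<^sup>2 - 6 t + 1 = 0\<close>, and \<open>t = (3 - q) / r\<close> with \<open>q = sqrt (9 - r)\<close> is a root of this equation.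
  The square root of \<open>K\<^sup>2 = 9 - r\<close> is the constant below.
\<close>

definition coord_scale :: "'n::finite itself \<Rightarrow> real" where
  "coord_scale _ = sqrt (9 - real CARD('n))"

definition pic_coords :: "(real, 'n::finite) pic \<Rightarrow> real ^ 'n" where
  "pic_coords D = snd D + ((3 - coord_scale TYPE('n)) / real CARD('n) * fst D) *\<^sub>R 1"

text \<open>
  The inverse isometry.  The correction multiplies the sum of the components by \<open>q / 3\<close>, hence the
  factor \<open>3 / q\<close> here.
\<close>

definition coords_pic :: "real ^ 'n::finite \<Rightarrow> (real, 'n) pic" where
  "coords_pic x =
     (- (\<Sum>i\<in>UNIV. x $ i) / coord_scale TYPE('n),
      x + ((3 / coord_scale TYPE('n) - 1) / real CARD('n) * (\<Sum>i\<in>UNIV. x $ i)) *\<^sub>R 1)"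

text \<open>
  The multiple of \<open>K\<close> in the hyperplane section of parameter \<open>1\<close>.  The reflections in roots fix \<open>K\<close>, so
  this is the point that has to correspond to the centre of the polytope.
\<close>

definition section_centre :: "(real, 'n::finite) pic" where
  "section_centre = - (1 / (9 - real CARD('n))) *\<^sub>R pic_K"

lemma linear_pic_coords: "linear pic_coords"
  by (rule linearI) (simp_all add: pic_coords_def vec_eq_iff algebra_simps add_divide_distrib diff_divide_distrib)

lemma linear_coords_pic: "linear (coords_pic :: real ^ 'n::finite \<Rightarrow> _)"
  by (rule linearI)
    (simp_all add: coords_pic_def prod_eq_iff vec_eq_iff sum.distrib sum_distrib_left[symmetric]
      algebra_simps add_divide_distrib diff_divide_distrib)

lemma coord_scale_props:
  assumes "CARD('n::finite) \<le> 8"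
  shows "coord_scale TYPE('n) > 0" "coord_scale TYPE('n) ^ 2 = 9 - real CARD('n)"
  using assms by (auto simp: coord_scale_def)

lemma inner_pic_coords:
  fixes D D' :: "(real, 'n::finite) pic"
  assumes "CARD('n) \<le> 8" and D: "D \<cdot>\<^sub>P pic_K = 0" and D': "D' \<cdot>\<^sub>P pic_K = 0"
  shows "pic_coords D \<bullet> pic_coords D' = - (D \<cdot>\<^sub>P D')"
proof -
  define q where "q = coord_scale TYPE('n)"
  define r where "r = real CARD('n)"
  define t where "t = (3 - q) / r"
  have r: "r > 0" by (simp add: r_def)
  have q2: "q\<^sup>2 = 9 - r"
    unfolding q_def r_def using coord_scale_props(2)[OF assms(1)] .
  have sums: "(\<Sum>i\<in>UNIV. snd D $ i) = - 3 * fst D" "(\<Sum>i\<in>UNIV. snd D' $ i) = - 3 * fst D'"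
    using D D' by (simp_all add: intersection_pic_K_right)
  have tr: "t * r = 3 - q"
    using r by (simp add: t_def)
  have "r * (t * t * r) = (t * r)\<^sup>2" by (simp add: power2_eq_square)
  also have "\<dots> = 6 * (t * r) - r" unfolding tr using q2 by (simp add: power2_diff)
  also have "\<dots> = r * (6 * t - 1)" by (simp add: algebra_simps)
  finally have t: "t * t * r = 6 * t - 1"
    using r by simp
  have "pic_coords D \<bullet> pic_coords D' =
    (\<Sum>i\<in>UNIV. (snd D $ i + t * fst D) * (snd D' $ i + t * fst D'))"
    by (simp add: pic_coords_def inner_vec_def t_def q_def r_def)
  also have "\<dots> = (\<Sum>i\<in>UNIV. snd D $ i * snd D' $ i) + t * fst D' * (\<Sum>i\<in>UNIV. snd D $ i)
      + t * fst D * (\<Sum>i\<in>UNIV. snd D' $ i) + (t * t * r) * (fst D * fst D')"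
    by (simp add: algebra_simps sum.distrib sum_distrib_left r_def)
  also have "\<dots> = - (D \<cdot>\<^sub>P D')"
    unfolding sums t by (simp add: intersection_def algebra_simps)
  finally show ?thesis .
qed

lemma coords_pic_orthogonal_K:
  fixes x :: "real ^ 'n::finite"
  assumes "CARD('n) \<le> 8"
  shows "coords_pic x \<cdot>\<^sub>P pic_K = 0"
  using coord_scale_props(1)[OF assms]
  by (simp add: intersection_pic_K_right coords_pic_def sum.distrib) (simp add: field_simps)

lemma pic_coords_coords_pic:
  fixes x :: "real ^ 'n::finite"
  assumes "CARD('n) \<le> 8"
  shows "pic_coords (coords_pic x) = x"
  using coord_scale_props(1)[OF assms]
  by (simp add: pic_coords_def coords_pic_def vec_eq_iff field_simps)

lemma coords_pic_pic_coords:
  fixes D :: "(real, 'n::finite) pic"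
  assumes "CARD('n) \<le> 8" and D: "D \<cdot>\<^sub>P pic_K = 0"
  shows "coords_pic (pic_coords D) = D"
proof -
  have S: "(\<Sum>i\<in>UNIV. snd D $ i) = - 3 * fst D"
    using D by (simp add: intersection_pic_K_right)
  have "(\<Sum>i\<in>UNIV. pic_coords D $ i) = - coord_scale TYPE('n) * fst D"
    by (simp add: pic_coords_def sum.distrib S) (simp add: algebra_simps)
  moreover have "(3 / q - 1) / r * (- q * f) = - ((3 - q) / r * f)" if "q > 0" for q r f :: real
    using that by (cases "r = 0") (simp_all add: field_simps)
  ultimately show ?thesis
    using coord_scale_props(1)[OF assms(1)]
    unfolding coords_pic_def by (simp only:) (simp add: pic_coords_def prod_eq_iff vec_eq_iff)
qed

lemma section_centre_K:
  assumes "CARD('n::finite) \<le> 8"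
  shows "(section_centre :: (real, 'n) pic) \<cdot>\<^sub>P pic_K = - 1"
proof -
  have "(pic_K :: (real, 'n) pic) \<cdot>\<^sub>P pic_K = 9 - real CARD('n)"
    by (simp add: intersection_def pic_K_eq)
  moreover have "9 - real CARD('n) \<noteq> 0" using assms by linarith
  ultimately show ?thesis
    by (simp add: section_centre_def intersection_minus_left intersection_scaleR_left)
qed

lemma intersection_section_centre:
  assumes "D \<cdot>\<^sub>P pic_K = 0"
  shows "D \<cdot>\<^sub>P section_centre = 0"
  using assms
  by (simp add: section_centre_def intersection_commute[of D] intersection_scaleR_left
      intersection_minus_left)

text \<open>
  The coordinates are isometric, so the factor of the similarity is \<open>1\<close>.
\<close>

lemma similarity_onto_section_coords:
  assumes "CARD('n::finite) \<le> 8"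
  shows "similarity_onto_section 1 (\<lambda>x :: real ^ 'n. section_centre + coords_pic x)"
  unfolding similarity_onto_section_def
proof
  show "range (\<lambda>x :: real ^ 'n. section_centre + coords_pic x) = hyperplane_section 1"
  proof
    show "range (\<lambda>x :: real ^ 'n. section_centre + coords_pic x) \<subseteq> hyperplane_section 1"
      using assms by (auto simp: hyperplane_section_def intersection_add_left section_centre_K
          coords_pic_orthogonal_K)
  next
    show "hyperplane_section 1 \<subseteq> range (\<lambda>x :: real ^ 'n. section_centre + coords_pic x)"
    proof
      fix D :: "(real, 'n) pic"
      assume "D \<in> hyperplane_section 1"
      then have "(D - section_centre) \<cdot>\<^sub>P pic_K = 0"
        using assms by (simp add: hyperplane_section_def intersection_diff_left section_centre_K)
      then have "D = section_centre + coords_pic (pic_coords (D - section_centre))"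
        using assms by (simp add: coords_pic_pic_coords)
      then show "D \<in> range (\<lambda>x :: real ^ 'n. section_centre + coords_pic x)"
        by blast
    qed
  qed
next
  have "- (coords_pic z \<cdot>\<^sub>P coords_pic z) = (norm z)\<^sup>2" for z :: "real ^ 'n"
    using inner_pic_coords[of "coords_pic z" "coords_pic z"] assms
    by (simp add: coords_pic_orthogonal_K pic_coords_coords_pic power2_norm_eq_inner)
  then show "\<exists>s>0. \<forall>x y :: real ^ 'n.
      - ((section_centre + coords_pic x - (section_centre + coords_pic y)) \<cdot>\<^sub>P
         (section_centre + coords_pic x - (section_centre + coords_pic y))) = (s * dist x y)\<^sup>2"
    by (intro exI[of _ 1])
      (simp add: linear_diff[OF linear_coords_pic, symmetric] dist_norm)
qed

text \<open>
  The difference of two distinct lines is a nonzero class orthogonal to \<open>K\<close>, where the form is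
  negative definite, and its square is \<open>- 2 - 2 (l \<cdot> l')\<close>.  So \<open>l \<cdot> l' > - 1\<close>, and intersection
  numbers are integers.
\<close>

lemma lines_intersection_nonneg:
  fixes l l' :: "(int, 'n::finite) pic"
  assumes "CARD('n) \<le> 8" "l \<in> lines_on_S" "l' \<in> lines_on_S" "l \<noteq> l'"
  shows "l \<cdot>\<^sub>P l' \<ge> 0"
proof -
  define D where "D = pic_real (l - l')"
  have K: "D \<cdot>\<^sub>P pic_K = 0"
    using assms(2,3) unfolding D_def
    by (simp add: pic_real_K[symmetric] intersection_pic_real intersection_diff_left
        lines_on_S_def)
  have "D \<noteq> 0"
    using assms(4) by (simp add: D_def pic_real_eq_0_iff)
  then have "pic_coords D \<noteq> 0"
    using coords_pic_pic_coords[OF assms(1) K] linear_0[OF linear_coords_pic] by metis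
  then have "D \<cdot>\<^sub>P D < 0"
    using inner_pic_coords[OF assms(1) K K] by (metis inner_gt_zero_iff neg_0_less_iff_less)
  then have "(l - l') \<cdot>\<^sub>P (l - l') < 0"
    by (simp add: D_def intersection_pic_real)
  then show ?thesis
    using assms(2,3)
    by (simp add: intersection_bilinear intersection_commute[of l' l] lines_on_S_def)
qed

section \<open>Distances to mirrors and extreme points\<close>

lemma infdist_mirror:
  fixes a x :: "'a::euclidean_space"
  assumes "a \<bullet> a = 1"
  shows "infdist x (mirror a) = \<bar>a \<bullet> x\<bar>"
proof (rule antisym)
  have n: "norm a = 1" using assms by (simp add: norm_eq_1)
  have "x - (a \<bullet> x) *\<^sub>R a \<in> mirror a"
    using assms by (simp add: mirror_def inner_diff_right)
  then have "infdist x (mirror a) \<le> dist x (x - (a \<bullet> x) *\<^sub>R a)" by (rule infdist_le)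
  then show "infdist x (mirror a) \<le> \<bar>a \<bullet> x\<bar>" by (simp add: dist_norm n)
  have "\<bar>a \<bullet> x\<bar> \<le> dist x y" if "y \<in> mirror a" for y
    using that Cauchy_Schwarz_ineq2[of a "x - y"]
    by (simp add: mirror_def inner_diff_right dist_norm n)
  moreover have "mirror a \<noteq> {}" by (auto simp: mirror_def intro: exI[of _ 0])
  ultimately show "\<bar>a \<bullet> x\<bar> \<le> infdist x (mirror a)"
    by (auto simp: infdist_notempty intro: cINF_greatest)
qed

text \<open>
  A sphere is strictly convex: the tangent hyperplane at a point \<open>x\<close> of the sphere touches the ball
  in \<open>x\<close> alone, and so supports the convex hull in \<open>x\<close> alone.
\<close>

lemma extreme_points_convex_hull_in_sphere:
  fixes S :: "'a::euclidean_space set"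
  assumes "\<And>x. x \<in> S \<Longrightarrow> norm x = R"
  shows "{x. x extreme_point_of (convex hull S)} = S"
proof
  show "{x. x extreme_point_of (convex hull S)} \<subseteq> S"
    using extreme_point_of_convex_hull by blast
  have hull: "convex hull S \<subseteq> cball 0 R"
    using assms by (intro hull_minimal) (auto simp: convex_cball)
  show "S \<subseteq> {x. x extreme_point_of (convex hull S)}"
  proof
    fix x assume "x \<in> S"
    have "x \<bullet> y \<le> R\<^sup>2 \<and> (x \<bullet> y = R\<^sup>2 \<longrightarrow> y = x)" if "y \<in> convex hull S" for y
    proof -
      have "norm y \<le> R" using that hull by auto
      then have "(norm y)\<^sup>2 \<le> R\<^sup>2" by (intro power_mono) auto
      moreover have "(norm (x - y))\<^sup>2 = (norm x)\<^sup>2 - 2 * (x \<bullet> y) + (norm y)\<^sup>2"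
        by (simp add: power2_norm_eq_inner inner_diff_left inner_diff_right inner_commute)
      ultimately have distance: "(norm (x - y))\<^sup>2 \<le> 2 * (R\<^sup>2 - x \<bullet> y)"
        using assms[OF \<open>x \<in> S\<close>] by simp
      then have "0 \<le> 2 * (R\<^sup>2 - x \<bullet> y)"
        by (rule order_trans[OF zero_le_power2])
      moreover have "y = x" if "x \<bullet> y = R\<^sup>2"
        using distance that by simp
      ultimately show ?thesis by simp
    qed
    moreover have "x \<bullet> x = R\<^sup>2"
      using assms[OF \<open>x \<in> S\<close>] power2_norm_eq_inner[of x] by simp
    moreover have "x \<in> convex hull S" using \<open>x \<in> S\<close> by (rule hull_inc)
    ultimately show "x \<in> {x. x extreme_point_of (convex hull S)}"
      by (auto intro!: extreme_point_of_Int_supporting_hyperplane_le[of _ x "R\<^sup>2"])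
  qed
qed

lemma extreme_points_injective_affine_image:
  fixes f :: "'a::euclidean_space \<Rightarrow> 'b::euclidean_space"
  assumes "linear f" "inj f"
  shows "{y. y extreme_point_of (\<lambda>x. c + f x) ` Q} = (\<lambda>x. c + f x) ` {x. x extreme_point_of Q}"
proof -
  have sub: "y \<in> S" if "y extreme_point_of S" for y and S :: "'b set"
    using that by (simp add: extreme_point_of_def)
  have "{y. y extreme_point_of f ` Q} = f ` {x. x extreme_point_of Q}"
    using face_of_linear_image[OF assms, of "{_}" Q] sub[of _ "f ` Q"]
    by (fastforce simp: face_of_singleton)
  moreover have "(\<lambda>x. c + f x) ` T = (+) c ` f ` T" for T
    by (simp add: image_image)
  ultimately show ?thesis
    by (simp only: extreme_points_of_translation)
qed

section \<open>Simple roots and descent on lines\<close>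

text \<open>
  For the numerical data of a line of degree \<open>a\<close> with multiplicities \<open>m\<close>, where the three largest
  multiplicities come first.  The sum of \<open>m\<^sub>k (m\<^sub>k - m\<^sub>3)\<close> is computed from the two equations.
  All its terms with \<open>k > 3\<close> are at most zero, so its first two terms bound it from above, and they
  are too small if \<open>m\<^sub>1 + m\<^sub>2 + m\<^sub>3 \<le> a\<close>.
\<close>

lemma noether_inequality:
  fixes m :: "nat \<Rightarrow> int"
  assumes r: "3 \<le> r"
    and linear: "(\<Sum>k=1..r. m k) = 3 * a - 1"
    and quadratic: "(\<Sum>k=1..r. (m k)\<^sup>2) = a\<^sup>2 + 1"
    and nonneg: "\<And>k. k \<in> {1..r} \<Longrightarrow> 0 \<le> m k"
    and antimono: "\<And>k. k \<in> {3..r} \<Longrightarrow> m k \<le> m 3" "m 3 \<le> m 2" "m 2 \<le> m 1"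
  shows "a < m 1 + m 2 + m 3"
proof (rule ccontr)
  assume "\<not> a < m 1 + m 2 + m 3"
  (* The assumption becomes x + y \<le> z in terms of the excesses over m 3. *)
  define x y z where "x = m 1 - m 3" and "y = m 2 - m 3" and "z = a - 3 * m 3"
  have xyz: "0 \<le> x" "0 \<le> y" "x + y \<le> z"
    using antimono \<open>\<not> a < m 1 + m 2 + m 3\<close> by (auto simp: x_def y_def z_def)
  have m3: "0 \<le> m 3" using nonneg[of 3] r by simp
  have "a\<^sup>2 + 1 - m 3 * (3 * a - 1) = (\<Sum>k=1..r. m k * (m k - m 3))"
    unfolding linear[symmetric] quadratic[symmetric]
    by (simp add: sum_distrib_left sum_subtractf algebra_simps power2_eq_square)
  also have "\<dots> \<le> (\<Sum>k\<in>{1,2,3}. m k * (m k - m 3))"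
  proof -
    have "(\<Sum>k=1..r. m k * (m k - m 3)) =
        (\<Sum>k\<in>{1,2,3}. m k * (m k - m 3)) + (\<Sum>k\<in>{1..r} - {1,2,3}. m k * (m k - m 3))"
      using r by (subst sum.subset_diff[of "{1,2,3}"]) auto
    moreover have "(\<Sum>k\<in>{1..r} - {1,2,3}. m k * (m k - m 3)) \<le> 0"
    proof (rule sum_nonpos)
      fix k assume "k \<in> {1..r} - {1,2,3}"
      then have "k \<in> {1..r}" "k \<in> {3..r}" by auto
      then show "m k * (m k - m 3) \<le> 0"
        using nonneg antimono(1) by (simp add: mult_nonneg_nonpos)
    qed
    ultimately show ?thesis by simp
  qed
  also have "\<dots> = m 3 * (x + y) + x\<^sup>2 + y\<^sup>2"
    by (simp add: x_def y_def algebra_simps power2_eq_square)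
  also have "\<dots> \<le> m 3 * z + z\<^sup>2"
  proof -
    have "x\<^sup>2 + y\<^sup>2 \<le> (x + y)\<^sup>2" using xyz by (simp add: power2_sum)
    also have "\<dots> \<le> z\<^sup>2" using xyz by (intro power_mono) auto
    finally show ?thesis using m3 xyz(3) by (smt (verit) mult_left_mono)
  qed
  finally have "a\<^sup>2 + 1 - m 3 * (3 * a - 1) \<le> m 3 * z + z\<^sup>2" .
  moreover have "a = z + 3 * m 3" by (simp add: z_def)
  ultimately have "1 + m 3 + 2 * (z * m 3) \<le> 0"
    by (simp add: algebra_simps power2_eq_square)
  moreover have "0 \<le> z * m 3" using xyz m3 by simp
  ultimately show False using m3 by linarith
qed

text \<open>
  The diagram of \<open>E\<^sub>r\<close> requires an ordering of the blown-up points, numbered from \<open>1\<close> as the nodes of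
  the chain are.
\<close>

locale marked_points =
  fixes \<iota> :: "nat \<Rightarrow> 'n::finite"
  assumes marking: "bij_betw \<iota> {1..CARD('n)} UNIV"
    and card_ge_3: "3 \<le> CARD('n)"
    and card_le_8: "CARD('n) \<le> 8"
begin

definition e :: "nat \<Rightarrow> (int, 'n) pic" where
  "e k = pic_e (\<iota> k)"

definition simple_root :: "nat \<Rightarrow> (int, 'n) pic" where
  "simple_root i = (if i = 0 then pic_h - e 1 - e 2 - e 3 else e i - e (i + 1))"

lemma e_intersection:
  assumes "i \<in> {1..CARD('n)}" "j \<in> {1..CARD('n)}"
  shows "e i \<cdot>\<^sub>P e j = (if i = j then - 1 else 0)"
proof -
  have "\<iota> i = \<iota> j \<longleftrightarrow> i = j"
    using marking assms by (auto simp: bij_betw_def dest: inj_onD)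
  then show ?thesis
    by (simp add: e_def intersection_basis)
qed

lemma h_intersection: "pic_h \<cdot>\<^sub>P e i = 0" "e i \<cdot>\<^sub>P pic_h = 0" "(pic_h :: (int, 'n) pic) \<cdot>\<^sub>P pic_h = 1"
  by (simp_all add: e_def intersection_basis)

lemma e_in_lines: "e i \<in> lines_on_S"
  by (simp add: lines_on_S_def e_def intersection_basis intersection_pic_K_right)

lemma simple_root_K: "simple_root i \<cdot>\<^sub>P pic_K = 0"
  using e_in_lines
  by (auto simp: simple_root_def intersection_bilinear lines_on_S_def)
    (simp add: intersection_pic_K_right pic_h_def)

lemma simple_root_gram:
  assumes "i < CARD('n)" "j < CARD('n)"
  shows "simple_root i \<cdot>\<^sub>P simple_root j = (if i = j then - 2 else if E_edge i j then 1 else 0)"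
  using assms card_ge_3
  by (auto simp: simple_root_def intersection_bilinear e_intersection h_intersection E_edge_def
      doubleton_eq_iff split: if_splits)

lemma line_sums:
  assumes "l \<in> lines_on_S"
  shows "(\<Sum>k=1..CARD('n). l \<cdot>\<^sub>P e k) = 3 * (l \<cdot>\<^sub>P pic_h) - 1"
    and "(\<Sum>k=1..CARD('n). (l \<cdot>\<^sub>P e k)\<^sup>2) = (l \<cdot>\<^sub>P pic_h)\<^sup>2 + 1"
proof -
  have "(\<Sum>k=1..CARD('n). l \<cdot>\<^sub>P e k) = - (\<Sum>i\<in>UNIV. snd l $ i)"
    unfolding e_def
    by (subst sum.reindex_bij_betw[OF marking, of "\<lambda>i. l \<cdot>\<^sub>P pic_e i"])
      (simp add: intersection_pic_e_right sum_negf)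
  then show "(\<Sum>k=1..CARD('n). l \<cdot>\<^sub>P e k) = 3 * (l \<cdot>\<^sub>P pic_h) - 1"
    using assms by (simp add: lines_on_S_def intersection_pic_K_right intersection_pic_h_right)
  have "(\<Sum>k=1..CARD('n). (l \<cdot>\<^sub>P e k)\<^sup>2) = (\<Sum>i\<in>UNIV. (snd l $ i)\<^sup>2)"
    unfolding e_def
    by (subst sum.reindex_bij_betw[OF marking, of "\<lambda>i. (l \<cdot>\<^sub>P pic_e i)\<^sup>2"])
      (simp add: intersection_pic_e_right)
  then show "(\<Sum>k=1..CARD('n). (l \<cdot>\<^sub>P e k)\<^sup>2) = (l \<cdot>\<^sub>P pic_h)\<^sup>2 + 1"
    using assms
    by (simp add: lines_on_S_def intersection_def[of l l] intersection_pic_h_right power2_eq_square)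
qed

text \<open>
  On the simple roots \<open>e\<^sub>i - e\<^sub>i\<^sub>+\<^sub>1\<close>, dominance says that the multiplicities do not increase, and on
  \<open>h - e\<^sub>1 - e\<^sub>2 - e\<^sub>3\<close> that the conclusion of Noether's inequality fails.  Hence some multiplicity is
  negative, which only happens for the exceptional classes, and among these only \<open>e\<^sub>r\<close> has
  multiplicities in this order.
\<close>

lemma dominant_line:
  assumes l: "l \<in> lines_on_S"
    and dominant: "\<And>i. i < CARD('n) \<Longrightarrow> 0 \<le> l \<cdot>\<^sub>P simple_root i"
  shows "l = e CARD('n)"
proof -
  define m where "m k = l \<cdot>\<^sub>P e k" for k
  have adjacent: "m (Suc k) \<le> m k" if "1 \<le> k" "k < CARD('n)" for k
    using dominant[of k] that by (simp add: simple_root_def intersection_diff_right m_def)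
  have antimono: "m k \<le> m j" if "1 \<le> j" "j \<le> k" "k \<le> CARD('n)" for j k
    using that(2,1,3)
  proof (induction k rule: dec_induct)
    case (step n)
    then show ?case using adjacent[of n] by simp
  qed simp
  have "\<exists>k\<in>{1..CARD('n)}. m k < 0"
  proof (rule ccontr)
    assume "\<not> ?thesis"
    then have "l \<cdot>\<^sub>P pic_h < m 1 + m 2 + m 3"
      using card_ge_3 line_sums[OF l] antimono
      by (intro noether_inequality[of "CARD('n)"]) (auto simp: m_def[symmetric] not_less)
    with dominant[of 0] show False
      by (simp add: simple_root_def intersection_diff_right m_def)
  qed
  then obtain k where k: "k \<in> {1..CARD('n)}" "m k < 0" by blast
  then have "l = e k"
    using lines_intersection_nonneg[OF card_le_8 l e_in_lines[of k]] by (force simp: m_def)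
  moreover have "k = CARD('n)"
    using antimono[of k "CARD('n)"] k card_ge_3
    by (auto simp: m_def \<open>l = e k\<close> e_intersection split: if_splits)
  ultimately show ?thesis by simp
qed

text \<open>
  Any linear function that is positive on the simple roots serves the descent.  For this one the
  values are \<open>1 + 2 + 3\<close> on \<open>h - e\<^sub>1 - e\<^sub>2 - e\<^sub>3\<close> and \<open>(i + 1) - i\<close> on \<open>e\<^sub>i - e\<^sub>i\<^sub>+\<^sub>1\<close>.
\<close>

definition height :: "(int, 'n) pic \<Rightarrow> int" where
  "height D = (\<Sum>k=1..CARD('n). int k * (D \<cdot>\<^sub>P e k))"

lemma height_add: "height (D + D') = height D + height D'"
  by (simp add: height_def intersection_add_left algebra_simps sum.distrib)

lemma height_diff: "height (D - D') = height D - height D'"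
  by (simp add: height_def intersection_diff_left algebra_simps sum_subtractf)

lemma height_scale: "height (pic_scale c D) = c * height D"
  by (simp add: height_def intersection_pic_scale algebra_simps sum_distrib_left)

lemma height_e:
  assumes "k \<in> {1..CARD('n)}"
  shows "height (e k) = - int k"
proof -
  have "height (e k) = (\<Sum>j=1..CARD('n). if k = j then - int k else 0)"
    unfolding height_def using assms by (intro sum.cong) (auto simp: e_intersection)
  also have "\<dots> = - int k" using assms by simp
  finally show ?thesis .
qed

lemma height_simple_root:
  assumes "i < CARD('n)"
  shows "height (simple_root i) > 0"
proof -
  have "height pic_h = 0" by (simp add: height_def h_intersection)
  then show ?thesis
    using assms card_ge_3 by (auto simp: simple_root_def height_diff height_e)
qed

text \<open>
  Multiplicities of lines are at least \<open>-1\<close>, so the descent on the height stops.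
\<close>

lemma height_line_ge:
  assumes l: "l \<in> lines_on_S"
  shows "height l \<ge> - (\<Sum>k=1..CARD('n). int k)"
proof -
  have "l \<cdot>\<^sub>P e k \<ge> - 1" for k
    using lines_intersection_nonneg[OF card_le_8 l e_in_lines[of k]] e_in_lines[of k]
    by (cases "l = e k") (auto simp: lines_on_S_def)
  then have "int k * (l \<cdot>\<^sub>P e k) \<ge> - int k" for k
    using mult_left_mono[of "-1" "l \<cdot>\<^sub>P e k" "int k"] by simp
  then show ?thesis
    unfolding height_def sum_negf[symmetric] by (intro sum_mono) simp
qed

text \<open>
  Every line arises from \<open>e\<^sub>r\<close> by reflections in simple roots.  The induction runs over the height,
  shifted by its lower bound to become a natural number: as long as \<open>l \<cdot> \<alpha> < 0\<close> for some simple root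
  \<open>\<alpha>\<close>, the reflection adds a negative multiple of \<open>\<alpha>\<close> to \<open>l\<close>, and reflecting again gives back \<open>l\<close>.
\<close>

lemma lines_induct [consumes 1, case_names base step]:
  assumes l: "l \<in> lines_on_S"
    and base: "P (e CARD('n))"
    and step: "\<And>D i. i < CARD('n) \<Longrightarrow> P D \<Longrightarrow> P (root_reflection (simple_root i) D)"
  shows "P l"
  using l
proof (induction l rule: measure_induct_rule
    [of "\<lambda>l. nat (height l + (\<Sum>k=1..CARD('n). int k))"])
  case (less l)
  show ?case
  proof (cases "\<forall>i<CARD('n). 0 \<le> l \<cdot>\<^sub>P simple_root i")
    case True
    then show ?thesis using dominant_line[OF less.prems] base by simp
  next
    case False
    then obtain i where i: "i < CARD('n)" "l \<cdot>\<^sub>P simple_root i < 0" by force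
    define l' where "l' = root_reflection (simple_root i) l"
    have square: "simple_root i \<cdot>\<^sub>P simple_root i = - 2"
      using simple_root_gram i by simp
    have l': "l' \<in> lines_on_S"
      unfolding l'_def using root_reflection_preserves_lines square simple_root_K less.prems by blast
    have "height l' < height l"
      using i height_simple_root[OF i(1)]
      by (simp add: l'_def root_reflection_def height_add height_scale mult_neg_pos)
    then have "P l'"
      using less.IH[of l'] l' height_line_ge[OF l'] by simp
    then show ?thesis
      using step[OF i(1), of l'] root_reflection_involution[OF square] by (simp add: l'_def)
  qed
qed

section \<open>The Gosset polytope\<close>

definition vertex :: "(int, 'n) pic \<Rightarrow> real ^ 'n" where
  "vertex l = pic_coords (pic_real l - section_centre)"

text \<open>
  Simple roots have square \<open>-2\<close>, while the normals of a simple system have length one.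
\<close>

definition normal :: "nat \<Rightarrow> real ^ 'n" where
  "normal i = (1 / sqrt 2) *\<^sub>R pic_coords (pic_real (simple_root i))"

lemma real_simple_root_K: "pic_real (simple_root i) \<cdot>\<^sub>P pic_K = 0"
  using simple_root_K[of i]
  by (simp add: pic_real_K[symmetric] intersection_pic_real)

lemma real_line_minus_centre_K:
  fixes l :: "(int, 'n) pic"
  assumes "l \<in> lines_on_S"
  shows "(pic_real l - section_centre) \<cdot>\<^sub>P pic_K = 0"
proof -
  have "pic_real l \<cdot>\<^sub>P pic_K = - 1"
    using assms
    by (simp add: pic_real_K[symmetric] intersection_pic_real lines_on_S_def)
  then show ?thesis
    using section_centre_K[OF card_le_8] by (simp add: intersection_diff_left)
qed

lemma inner_normal_normal:
  "normal i \<bullet> normal j = - of_int (simple_root i \<cdot>\<^sub>P simple_root j) / 2"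
  by (simp add: normal_def inner_pic_coords[OF card_le_8 real_simple_root_K real_simple_root_K]
      intersection_pic_real)

lemma inner_root_vertex:
  assumes "l \<in> lines_on_S"
  shows "pic_coords (pic_real (simple_root i)) \<bullet> vertex l = - of_int (l \<cdot>\<^sub>P simple_root i)"
  unfolding vertex_def
    inner_pic_coords[OF card_le_8 real_simple_root_K real_line_minus_centre_K[OF assms]]
  by (simp add: intersection_diff_right intersection_section_centre[OF real_simple_root_K]
      intersection_pic_real intersection_commute[of l])

lemma inner_normal_vertex:
  assumes "l \<in> lines_on_S"
  shows "normal i \<bullet> vertex l = - of_int (l \<cdot>\<^sub>P simple_root i) / sqrt 2"
  by (simp add: normal_def inner_root_vertex[OF assms])

text \<open>
  The centre is a multiple of \<open>K\<close> and thus orthogonal to the roots, so subtracting it does not change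
  the coefficient of the root in the reflection formula.
\<close>

lemma reflection_vertex:
  assumes "i < CARD('n)" "l \<in> lines_on_S"
  shows "reflection (normal i) (vertex l) = vertex (root_reflection (simple_root i) l)"
proof -
  have "normal i \<bullet> normal i = 1"
    using assms by (simp add: inner_normal_normal simple_root_gram)
  then have "reflection (normal i) (vertex l) =
      vertex l + of_int (l \<cdot>\<^sub>P simple_root i) *\<^sub>R pic_coords (pic_real (simple_root i))"
    using assms by (simp add: reflection_def inner_normal_vertex) (simp add: normal_def field_simps)
  also have "\<dots> = vertex (root_reflection (simple_root i) l)"
    by (simp add: vertex_def root_reflection_def pic_real_add pic_real_scale
        linear_add[OF linear_pic_coords] linear_diff[OF linear_pic_coords]
        linear_scale[OF linear_pic_coords])
  finally show ?thesis .
qed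

lemma E_simple_system_normal: "E_simple_system CARD('n) normal"
  by (auto simp: E_simple_system_def inner_normal_normal simple_root_gram E_coxeter_matrix_def
      cos_60)

lemma orbit_eq_vertices:
  "(\<lambda>w. w (vertex (e CARD('n)))) ` reflection_group (normal ` {..<CARD('n)}) = vertex ` lines_on_S"
    (is "?O = _")
proof
  have "w (vertex (e CARD('n))) \<in> vertex ` lines_on_S"
    if "w \<in> reflection_group (normal ` {..<CARD('n)})" for w
    using that
  proof induction
    case one
    then show ?case using e_in_lines by simp
  next
    case (mult a w)
    then obtain i l where "i < CARD('n)" "a = normal i" "l \<in> lines_on_S"
      "w (vertex (e CARD('n))) = vertex l" by auto
    then show ?case
      using root_reflection_preserves_lines[of "simple_root i" l]
      by (simp add: reflection_vertex simple_root_gram simple_root_K)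
  qed
  then show "?O \<subseteq> vertex ` lines_on_S" by blast
next
  have "l \<in> lines_on_S \<and> vertex l \<in> ?O" if "l \<in> lines_on_S" for l
    using that
  proof (induction l rule: lines_induct)
    case base
    have "id (vertex (e CARD('n))) \<in> ?O" by (rule imageI) (rule reflection_group.one)
    then show ?case using e_in_lines by simp
  next
    case (step l i)
    then obtain w where w: "w \<in> reflection_group (normal ` {..<CARD('n)})"
      "vertex l = w (vertex (e CARD('n)))" by blast
    then have "reflection (normal i) \<circ> w \<in> reflection_group (normal ` {..<CARD('n)})"
      using step(1) by (intro reflection_group.mult) auto
    then have "(reflection (normal i) \<circ> w) (vertex (e CARD('n))) \<in> ?O" by (rule imageI)
    also have "(reflection (normal i) \<circ> w) (vertex (e CARD('n))) =
        vertex (root_reflection (simple_root i) l)"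
      using step reflection_vertex by (simp add: w(2)[symmetric])
    finally have "vertex (root_reflection (simple_root i) l) \<in> ?O" .
    then show ?case
      using step root_reflection_preserves_lines[of "simple_root i" l]
      by (simp add: simple_root_gram simple_root_K)
  qed
  then show "vertex ` lines_on_S \<subseteq> ?O" by blast
qed

text \<open>
  The radius depends only on \<open>l \<cdot> l\<close> and \<open>l \<cdot> K\<close>, which are the same for all lines.
\<close>

lemma norm_vertex:
  assumes "l \<in> lines_on_S"
  shows "(norm (vertex l))\<^sup>2 = 1 + 1 / (9 - real CARD('n))"
proof -
  let ?c = "section_centre :: (real, 'n) pic"
  have pos: "9 - real CARD('n) > 0" using card_le_8 by simp
  have "(norm (vertex l))\<^sup>2 = - ((pic_real l - ?c) \<cdot>\<^sub>P (pic_real l - ?c))"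
    using inner_pic_coords[OF card_le_8 real_line_minus_centre_K[OF assms]
        real_line_minus_centre_K[OF assms]]
    by (simp add: vertex_def power2_norm_eq_inner)
  also have "\<dots> = - ((pic_real l - ?c) \<cdot>\<^sub>P pic_real l)"
    using intersection_section_centre[OF real_line_minus_centre_K[OF assms]]
    by (simp add: intersection_diff_right)
  also have "\<dots> = 1 + 1 / (9 - real CARD('n))"
  proof -
    have "pic_real l \<cdot>\<^sub>P pic_K = - 1"
      using assms
      by (simp add: pic_real_K[symmetric] intersection_pic_real lines_on_S_def)
    then show ?thesis
      using assms
      by (simp add: intersection_diff_left intersection_pic_real lines_on_S_def section_centre_def
          intersection_add_left
          intersection_scaleR_left intersection_minus_left intersection_commute[of pic_K])
  qed
  finally show ?thesis .
qed

text \<open>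
  For \<open>r = 3\<close> the class \<open>e\<^sub>3\<close> occurs with coefficient \<open>-1\<close> in the roots of the nodes \<open>0\<close> and \<open>2\<close>, and equal
  intersection numbers give equal distances to the two mirrors.  For \<open>r \<ge> 4\<close> the class \<open>e\<^sub>r\<close> occurs
  only in the root of the last node.
\<close>

lemma gosset_generator_vertex: "gosset_generator CARD('n) normal (vertex (e CARD('n)))"
proof -
  have mirror: "vertex (e CARD('n)) \<in> mirror (normal i) \<longleftrightarrow> e CARD('n) \<cdot>\<^sub>P simple_root i = 0" for i
    by (simp add: mirror_def inner_normal_vertex e_in_lines)
  have dist: "infdist (vertex (e CARD('n))) (mirror (normal i)) =
      \<bar>of_int (e CARD('n) \<cdot>\<^sub>P simple_root i)\<bar> / sqrt 2" if "i < CARD('n)" for i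
    using that
    by (simp add: infdist_mirror inner_normal_normal simple_root_gram inner_normal_vertex e_in_lines)
  show ?thesis
  proof (cases "CARD('n) = 3")
    case True
    then show ?thesis
      unfolding gosset_generator_def
      using mirror dist
      by (simp add: simple_root_def intersection_diff_right e_intersection h_intersection)
  next
    case False
    have "e CARD('n) \<cdot>\<^sub>P simple_root (CARD('n) - 1) = 1"
      using card_ge_3 by (simp add: simple_root_def intersection_diff_right e_intersection)
    moreover have "e CARD('n) \<cdot>\<^sub>P simple_root i = 0" if "i < CARD('n) - 1" for i
      using card_ge_3 that False
      by (auto simp: simple_root_def intersection_diff_right e_intersection h_intersection)
    moreover have "0 \<in> mirror (normal i)" for i by (simp add: mirror_def)
    ultimately show ?thesis
      using False mirror unfolding gosset_generator_def by (metis zero_neq_one)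
  qed
qed

lemma gosset_polytope_convex_hull_vertices:
  "gosset_polytope CARD('n) (convex hull (vertex ` lines_on_S))"
  unfolding gosset_polytope_def orbit_eq_vertices[symmetric]
  using E_simple_system_normal gosset_generator_vertex by auto

lemma extreme_points_lines:
  "{x. x extreme_point_of
      (\<lambda>x. section_centre + coords_pic x) ` (convex hull (vertex ` lines_on_S))} =
    pic_real ` lines_on_S"
proof -
  have "inj (coords_pic :: real ^ 'n \<Rightarrow> _)"
    by (rule inj_on_inverseI) (rule pic_coords_coords_pic[OF card_le_8])
  moreover have "norm x = sqrt (1 + 1 / (9 - real CARD('n)))" if "x \<in> vertex ` lines_on_S" for x
    using that norm_vertex by (metis imageE norm_ge_zero real_sqrt_unique)
  ultimately have "{x. x extreme_point_of
      (\<lambda>x. section_centre + coords_pic x) ` (convex hull (vertex ` lines_on_S))} =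
    (\<lambda>x. section_centre + coords_pic x) ` vertex ` lines_on_S"
    by (simp add: extreme_points_injective_affine_image linear_coords_pic
        extreme_points_convex_hull_in_sphere)
  also have "\<dots> = pic_real ` lines_on_S"
    unfolding image_image vertex_def
    by (intro image_cong)
      (simp_all add: coords_pic_pic_coords[OF card_le_8 real_line_minus_centre_K])
  finally show ?thesis .
qed

end

theorem theorem4:
  fixes p :: "'n::finite \<Rightarrow> 'k::alg_closed_field ^ 3"
  assumes "3 \<le> CARD('n)" and "CARD('n) \<le> 8"
    and "general_position p"
  shows "\<exists>P :: (real, 'n) pic set.
           gosset_polytope_in_section 1 P \<and>
           pic_real ` (lines_on_S :: (int, 'n) pic set) = {x. x extreme_point_of P}"
proof -
  obtain \<iota> :: "nat \<Rightarrow> 'n" where "bij_betw \<iota> {1..CARD('n)} UNIV"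
    using ex_bij_betw_nat_finite_1[of "UNIV :: 'n set"] by auto
  then interpret marked_points \<iota>
    using assms by unfold_locales
  show ?thesis
    unfolding gosset_polytope_in_section_def
    using similarity_onto_section_coords[OF assms(2)] gosset_polytope_convex_hull_vertices
      extreme_points_lines by blast
qed

end
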